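(* For integers $k\ge 1$ and $n\ge 0$, the number of $132$-avoiding $k$-ary shrub forests with $n$ shrubs is $$\left|\mathcal{F}^k_n(132)\right|=\frac{1}{(k+1)n+1}\binom{(k+2)n}{n}.$$
   Context: A $k$-ary shrub is a rooted tree whose root has exactly $k$ children, all leaves. A $k$-ary shrub forest of $n$ shrubs is an ordered sequence of $n$ such shrubs (leaves ordered left to right) whose $(k+1)n$ vertices are labeled bijectively by $\{1,\dots,(k+1)n\}$ so that each leaf has a larger label than its root; its permutation $\pi_F$ is read shrub by shrub, root label first and then leaf labels from left to right. Equivalently, forests correspond to permutations $\pi$ of $\{1,\dots,(k+1)n\}$ with $\pi_{(k+1)i+1}<\pi_{(k+1)i+j}$ for $0\le i<n$, $2\le j\le k+1$. $\mathcal{F}^k_n(P)$ is the set of such forests whose permutation avoids (classically) all patterns in $P$. *)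

theory Defs
  imports Complex_Main "HOL-Library.Sublist"
begin

text \<open>A labeled shrub is given by the label of its root and the labels of its leaves,
  from left to right.\<close>

datatype shrub = Shrub (root_label: nat) (leaf_labels: "nat list")

definition kary_shrub :: "nat \<Rightarrow> shrub \<Rightarrow> bool" where
  "kary_shrub k s \<longleftrightarrow> length (leaf_labels s) = k"

definition shrub_word :: "shrub \<Rightarrow> nat list" where
  "shrub_word s = root_label s # leaf_labels s"

definition forest_perm :: "shrub list \<Rightarrow> nat list" where
  "forest_perm F = concat (map shrub_word F)"

definition shrub_forest :: "nat \<Rightarrow> nat \<Rightarrow> shrub list \<Rightarrow> bool" where
  "shrub_forest k n F \<longleftrightarrow>
     length F = n \<and>
     (\<forall>s \<in> set F. kary_shrub k s) \<and>
     distinct (forest_perm F) \<and> set (forest_perm F) = {1..(k + 1) * n} \<and>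
     (\<forall>s \<in> set F. \<forall>x \<in> set (leaf_labels s). root_label s < x)"

definition order_isomorphic :: "nat list \<Rightarrow> nat list \<Rightarrow> bool" where
  "order_isomorphic xs ys \<longleftrightarrow>
     length xs = length ys \<and>
     (\<forall>i < length xs. \<forall>j < length xs. xs ! i < xs ! j \<longleftrightarrow> ys ! i < ys ! j)"

text \<open>Classical containment: the entries of the occurrence need not be adjacent
  (\<^const>\<open>subseq\<close> is the not necessarily contiguous sublist relation).
  Patterns are written in one-line notation.\<close>

definition contains_pattern :: "nat list \<Rightarrow> nat list \<Rightarrow> bool" where
  "contains_pattern \<pi> \<sigma> \<longleftrightarrow> (\<exists>xs. subseq xs \<pi> \<and> order_isomorphic xs \<sigma>)"

definition avoiding_forests :: "nat \<Rightarrow> nat \<Rightarrow> nat list set \<Rightarrow> shrub list set" where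
  "avoiding_forests k n P =
     {F. shrub_forest k n F \<and> (\<forall>\<sigma> \<in> P. \<not> contains_pattern (forest_perm F) \<sigma>)}"

end

theory Submission
  imports Defs
begin

text \<open>Read a forest from right to left. In a \<open>132\<close>-avoiding word the labels to the right of a
  given label and larger than it must increase; for the first shrub this forces its labels to be
  \<open>k + 1\<close> consecutive integers in increasing order. So a forest with \<open>n + 1\<close> shrubs
  arises uniquely from one with \<open>n\<close> shrubs by inserting such a block just below the \<open>d\<close>
  largest labels, which is allowed iff these labels appear in increasing order. If this is the
  case precisely for \<open>d \<le> t\<close>, then after the insertion at \<open>d\<close> the new bound is
  \<open>d + k + 1\<close>. Hence the forests are counted by the sequences of bounds, and these are
  counted by Raney numbers.\<close>

section \<open>Raney numbers\<close>

text \<open>Counts the sequences of \<open>n\<close> insertion depths when the current bound is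
  \<open>t\<close>: a depth \<open>d \<le> t\<close> is chosen, and the next bound is
  \<open>d + m\<close>.\<close>

fun raney :: "nat \<Rightarrow> nat \<Rightarrow> nat \<Rightarrow> nat" where
  "raney m 0 t = 1"
| "raney m (Suc n) t = (\<Sum>d\<le>t. raney m n (d + m))"

text \<open>The closed form \<open>r / (p n + r) * (p n + r choose n)\<close>, with \<open>p = m + 1\<close> and
  \<open>r = t + 1\<close>, written as a difference so that the recursion is Pascal's rule.\<close>

lemma raney_Suc_eq:
  "int (raney m (Suc n) t) =
     int ((Suc m * Suc n + Suc t) choose Suc n) - int (Suc m) * int ((Suc m * Suc n + t) choose n)"
proof (induction n arbitrary: t)
  case 0
  show ?case by (induction t) auto
next
  case (Suc n)
  define p where "p = Suc m"
  have step: "int (raney m (Suc n) (t + m)) =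
      int ((p * Suc (Suc n) + t) choose Suc n) - int p * int ((p * Suc (Suc n) + t - 1) choose n)"
    for t
  proof -
    have "Suc m * Suc n + Suc (t + m) = p * Suc (Suc n) + t"
      "Suc m * Suc n + (t + m) = p * Suc (Suc n) + t - 1"
      by (simp_all add: p_def)
    then show ?thesis unfolding Suc.IH p_def[symmetric] by simp
  qed
  \<comment> \<open>Needed for \<open>t = 0\<close>: after Pascal's rule on both binomials of the
    goal, these are the two terms left to cancel.\<close>
  have absorb: "(p * Suc (Suc n)) choose Suc (Suc n) = p * ((p * Suc (Suc n) - 1) choose Suc n)"
  proof -
    have "Suc (Suc n) * ((p * Suc (Suc n)) choose Suc (Suc n)) =
        (p * Suc (Suc n)) * ((p * Suc (Suc n) - 1) choose Suc n)"
      by (rule binomial_absorption)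
    also have "\<dots> = Suc (Suc n) * (p * ((p * Suc (Suc n) - 1) choose Suc n))"
      by (simp only: mult_ac)
    finally show ?thesis by (metis mult_left_cancel nat.distinct(1))
  qed
  \<comment> \<open>The upper argument becomes a successor, so that Pascal's rule applies as a
    rewrite rule.\<close>
  obtain q where q: "p * Suc (Suc n) = Suc q"
    by (simp add: p_def)
  show ?case
    unfolding p_def[symmetric]
  proof (induction t)
    case 0
    show ?case using step[of 0] absorb unfolding q
      by (simp add: algebra_simps del: raney.simps(2) add: raney.simps(2)[of m "Suc n" 0])
  next
    case (Suc t)
    have "raney m (Suc (Suc n)) (Suc t) =
        raney m (Suc (Suc n)) t + raney m (Suc n) (Suc t + m)"
      by (simp only: raney.simps(2)[of m "Suc n"] sum.atMost_Suc)
    then show ?case using step[of "Suc t"] Suc.IH unfolding q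
      by (simp add: algebra_simps del: raney.simps)
  qed
qed

lemma raney_0_eq:
  "real (raney m n 0) = 1 / real (m * n + 1) * real ((Suc m * n) choose n)"
proof (cases n)
  case 0
  then show ?thesis by simp
next
  case (Suc i)
  define N where "N = Suc m * Suc i"
  define a where "a = real (N choose i)"
  define b where "b = real (N choose Suc i)"
  have N: "real N = (real m + 1) * (real i + 1)"
    unfolding N_def by (simp add: algebra_simps)
  have "i \<le> N" by (simp add: N_def)
  have "real_of_int (int (raney m (Suc i) 0)) = a + b - (real m + 1) * a"
    unfolding raney_Suc_eq N_def[symmetric] a_def b_def by (simp add: algebra_simps)
  then have r: "real (raney m (Suc i) 0) = b - real m * a"
    by (simp add: algebra_simps)
  \<comment> \<open>The ratio of neighbouring binomial coefficients expresses \<open>b\<close>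
    through \<open>a\<close>; here \<open>N - i = m * (i + 1) + 1\<close>.\<close>
  have "Suc i * (N choose Suc i) = (N - i) * (N choose i)"
    by (metis binomial_absorb_comp binomial_absorption diff_Suc_1 N_def)
  then have "real (Suc i) * b = real (N - i) * a"
    unfolding a_def b_def by (metis of_nat_mult)
  then have "real (Suc i) * b = (real m * (real i + 1) + 1) * a"
    using \<open>i \<le> N\<close> by (simp add: of_nat_diff N algebra_simps)
  then have "(real i + 1) * b = (real m * (real i + 1) + 1) * a"
    by (simp add: algebra_simps)
  then have "(b - real m * a) * (real m * (real i + 1) + 1) = b"
    by algebra
  moreover have "real m * (real i + 1) + 1 > 0"
    by (simp add: add_nonneg_pos)
  ultimately have "b - real m * a = 1 / (real m * (real i + 1) + 1) * b"
    by (simp add: field_simps)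
  moreover have "real (m * Suc i + 1) = real m * (real i + 1) + 1"
    by (simp add: algebra_simps)
  ultimately show ?thesis
    unfolding Suc r b_def N_def by (simp only:)
qed

section \<open>Words avoiding 132\<close>

text \<open>The head plays the smallest entry of a possible occurrence. This recursion suits words
  that grow by prepending a shrub.\<close>

fun avoids_132 :: "nat list \<Rightarrow> bool" where
  "avoids_132 [] \<longleftrightarrow> True"
| "avoids_132 (x # xs) \<longleftrightarrow> sorted (filter (\<lambda>y. x < y) xs) \<and> avoids_132 xs"

lemma subseq_Cons_Cons_iff:
  "subseq (y # ys) (x # xs) \<longleftrightarrow> y = x \<and> subseq ys xs \<or> subseq (y # ys) xs"
  by (metis subseq_Cons' subseq_Cons2_iff)

lemma sorted_iff_subseq:
  fixes xs :: "'a::linorder list"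
  shows "sorted xs \<longleftrightarrow> (\<forall>y z. subseq [y, z] xs \<longrightarrow> y \<le> z)"
proof (induction xs)
  case Nil
  show ?case by simp
next
  case (Cons x xs)
  then show ?case by (auto simp: subseq_Cons_Cons_iff subseq_singleton_left simp del: subseq_Cons2_iff)
qed

lemma subseq_filter_iff:
  "subseq ys (filter P xs) \<longleftrightarrow> subseq ys xs \<and> (\<forall>y\<in>set ys. P y)"
proof
  assume sub: "subseq ys (filter P xs)"
  then show "subseq ys xs \<and> (\<forall>y\<in>set ys. P y)"
    using subseq_order.trans[OF sub subseq_filter_left] list_emb_set[OF sub]
    by (metis (mono_tags, lifting) filter_is_subset mem_Collect_eq set_filter)
next
  assume "subseq ys xs \<and> (\<forall>y\<in>set ys. P y)"
  then show "subseq ys (filter P xs)"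
    by (metis filter_True subseq_filter)
qed

lemma order_isomorphic_132_iff:
  "order_isomorphic xs [1, 3, 2] \<longleftrightarrow> (\<exists>x y z. xs = [x, y, z] \<and> x < z \<and> z < y)"
proof
  assume iso: "order_isomorphic xs [1, 3, 2]"
  then have "length xs = 3" by (simp add: order_isomorphic_def)
  then obtain x y z where xs: "xs = [x, y, z]"
    by (auto simp: numeral_3_eq_3 length_Suc_conv)
  with iso show "\<exists>x y z. xs = [x, y, z] \<and> x < z \<and> z < y"
    unfolding order_isomorphic_def by (auto simp: numeral_3_eq_3 All_less_Suc)
next
  assume "\<exists>x y z. xs = [x, y, z] \<and> x < z \<and> z < y"
  then show "order_isomorphic xs [1, 3, 2]"
    unfolding order_isomorphic_def by clarify (simp add: All_less_Suc)
qed

text \<open>An occurrence either lies in the tail or starts at the head \<open>a\<close>; in the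
  latter case its other two entries form a descent among the later entries above
  \<open>a\<close>.\<close>

lemma avoids_132_iff_subseq:
  "avoids_132 xs \<longleftrightarrow> \<not> (\<exists>x y z. subseq [x, y, z] xs \<and> x < z \<and> z < y)"
proof (induction xs)
  case Nil
  show ?case by simp
next
  case (Cons a xs)
  have "(\<forall>y z. subseq [y, z] xs \<and> a < y \<and> a < z \<longrightarrow> y \<le> z) \<longleftrightarrow>
      \<not> (\<exists>y z. subseq [y, z] xs \<and> a < z \<and> z < y)"
    by (meson leD leI less_trans)
  then have "sorted (filter (\<lambda>y. a < y) xs) \<longleftrightarrow>
      \<not> (\<exists>y z. subseq [y, z] xs \<and> a < z \<and> z < y)"
    unfolding sorted_iff_subseq subseq_filter_iff by simp
  then show ?case
    using Cons.IH unfolding avoids_132.simps subseq_Cons_Cons_iff by blast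
qed

lemma contains_132_iff: "contains_pattern xs [1, 3, 2] \<longleftrightarrow> \<not> avoids_132 xs"
  unfolding contains_pattern_def order_isomorphic_132_iff avoids_132_iff_subseq by blast

lemma filter_less_map:
  assumes "strict_mono (g :: nat \<Rightarrow> nat)"
  shows "filter (\<lambda>y. g x < y) (map g xs) = map g (filter (\<lambda>y. x < y) xs)"
  using strict_mono_less[OF assms] by (simp add: filter_map o_def)

lemma sorted_map_strict_mono:
  assumes "strict_mono (g :: nat \<Rightarrow> nat)"
  shows "sorted (map g xs) \<longleftrightarrow> sorted xs"
  using strict_mono_less_eq[OF assms] by (simp add: sorted_map)

lemma avoids_132_map:
  assumes "strict_mono g"
  shows "avoids_132 (map g xs) \<longleftrightarrow> avoids_132 xs"
  by (induction xs) (simp_all add: filter_less_map[OF assms] sorted_map_strict_mono[OF assms]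
      del: filter_map)

section \<open>Inserting a shrub\<close>

definition relabel :: "(nat \<Rightarrow> nat) \<Rightarrow> shrub \<Rightarrow> shrub" where
  "relabel g s = Shrub (g (root_label s)) (map g (leaf_labels s))"

text \<open>The increasing map onto the naturals outside \<open>{v..<v + m}\<close>; it makes room
  for a block of \<open>m\<close> new labels.\<close>

definition skip :: "nat \<Rightarrow> nat \<Rightarrow> nat \<Rightarrow> nat" where
  "skip m v x = (if x < v then x else x + m)"

definition add_shrub :: "nat \<Rightarrow> nat \<Rightarrow> shrub list \<Rightarrow> shrub list" where
  "add_shrub k v F = Shrub v [Suc v..<v + Suc k] # map (relabel (skip (Suc k) v)) F"

lemma forest_perm_Cons: "forest_perm (s # F) = shrub_word s @ forest_perm F"
  by (simp add: forest_perm_def)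

lemma forest_perm_relabel: "forest_perm (map (relabel g) F) = map g (forest_perm F)"
  by (induction F) (simp_all add: forest_perm_def relabel_def shrub_word_def)

lemma forest_perm_add_shrub:
  "forest_perm (add_shrub k v F) = [v..<v + Suc k] @ map (skip (Suc k) v) (forest_perm F)"
  by (simp add: add_shrub_def forest_perm_Cons forest_perm_relabel shrub_word_def upt_conv_Cons
      del: upt_Suc)

lemma strict_mono_skip: "strict_mono (skip m v)"
  by (auto simp: strict_mono_def skip_def)

lemma inj_skip: "inj (skip m v)"
  by (simp add: strict_mono_imp_inj_on strict_mono_skip)

lemma inj_relabel:
  assumes "inj g"
  shows "inj (relabel g)"
proof (rule injI)
  fix s t
  assume "relabel g s = relabel g t"
  then show "s = t"
    using assms by (cases s; cases t) (auto simp: relabel_def inj_eq inj_map_eq_map)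
qed

lemma skip_image:
  assumes "1 \<le> v" "v \<le> Suc N"
  shows "skip m v ` {1..N} = {1..N + m} - {v..<v + m}"
proof -
  have "x \<in> skip m v ` {1..N}" if "x \<in> {1..N + m} - {v..<v + m}" for x
  proof (cases "x < v")
    case True
    then show ?thesis using that assms by (intro image_eqI[of _ _ x]) (auto simp: skip_def)
  next
    case False
    then show ?thesis
      using that assms by (intro image_eqI[of _ _ "x - m"]) (auto simp: skip_def)
  qed
  moreover have "skip m v ` {1..N} \<subseteq> {1..N + m} - {v..<v + m}"
    by (auto simp: skip_def)
  ultimately show ?thesis by blast
qed

text \<open>The depths at which a block may be inserted: in a word on \<open>{1..N}\<close> the
  entries above \<open>N - d\<close> are the \<open>d\<close> largest. The condition
  \<open>d \<le> N\<close> keeps the truncated subtraction exact and the set finite.\<close>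

definition admissible :: "nat \<Rightarrow> nat list \<Rightarrow> nat set" where
  "admissible N xs = {d. d \<le> N \<and> sorted (filter (\<lambda>x. N - d < x) xs)}"

lemma filter_skip_block:
  "filter (\<lambda>x. v \<le> x) ([v..<v + m] @ map (skip m v) xs) =
     [v..<v + m] @ map (skip m v) (filter (\<lambda>x. v \<le> x) xs)"
proof -
  have "filter (\<lambda>x. v \<le> x) [v..<v + m] = [v..<v + m]"
    by (simp add: filter_id_conv)
  moreover have "(\<lambda>x. v \<le> skip m v x) = (\<lambda>x. v \<le> x)"
    by (auto simp: skip_def fun_eq_iff)
  ultimately show ?thesis
    by (simp add: filter_map o_def)
qed

text \<open>The filtered entries move to \<open>v + m\<close> or higher, above the whole block. The
  start \<open>u\<close> is free so that the lemma also covers final segments of the block.\<close>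

lemma sorted_block_append:
  "sorted ([u..<v + m] @ map (skip m v) (filter (\<lambda>x. v \<le> x) xs)) \<longleftrightarrow>
     sorted (filter (\<lambda>x. v \<le> x) xs)"
  by (auto simp: sorted_append sorted_map_strict_mono[OF strict_mono_skip] skip_def)

text \<open>To the right of a block entry, the larger entries are the rest of the block and the
  images of the labels from \<open>v\<close> on. So every block entry imposes the same condition on
  \<open>xs\<close>.\<close>

lemma avoids_132_block:
  assumes "0 < m"
  shows "avoids_132 ([v..<v + m] @ map (skip m v) xs) \<longleftrightarrow>
    sorted (filter (\<lambda>x. v \<le> x) xs) \<and> avoids_132 xs"
proof -
  \<comment> \<open>Induction on the number \<open>j\<close> of block entries kept, taken from the
    end of the block; with none kept the sortedness condition is absent.\<close>
  have gen: "avoids_132 ([v + m - j..<v + m] @ map (skip m v) xs) \<longleftrightarrow>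
      (0 < j \<longrightarrow> sorted (filter (\<lambda>x. v \<le> x) xs)) \<and> avoids_132 xs" if "j \<le> m" for j
    using that
  proof (induction j)
    case 0
    then show ?case by (simp add: avoids_132_map[OF strict_mono_skip])
  next
    case (Suc j)
    define u where "u = v + m - Suc j"
    have u: "[v + m - Suc j..<v + m] = u # [Suc u..<v + m]" "v + m - j = Suc u"
      using Suc.prems by (auto simp: u_def upt_conv_Cons)
    have "v \<le> u" "u < v + m"
      using Suc.prems by (auto simp: u_def)
    then have "(\<lambda>x. u < skip m v x) = (\<lambda>x. v \<le> x)"
      by (auto simp: skip_def fun_eq_iff)
    moreover have "filter (\<lambda>y. u < y) [Suc u..<v + m] = [Suc u..<v + m]"
      by (simp add: filter_id_conv)
    ultimately have "filter (\<lambda>y. u < y) ([Suc u..<v + m] @ map (skip m v) xs) =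
        [Suc u..<v + m] @ map (skip m v) (filter (\<lambda>x. v \<le> x) xs)"
      by (simp add: filter_map o_def)
    then show ?case
      using Suc unfolding u by (auto simp: sorted_block_append)
  qed
  show ?thesis using gen[of m] assms by simp
qed

lemma admissible_block:
  assumes d: "d \<in> admissible N xs" and xs: "set xs = {1..N}" and "0 < m"
    and v: "v = Suc N - d"
  shows "admissible (N + m) ([v..<v + m] @ map (skip m v) xs) = {..d + m}"
proof -
  let ?w = "[v..<v + m] @ map (skip m v) xs"
  have "d \<le> N" and srt: "sorted (filter (\<lambda>x. N - d < x) xs)"
    using d by (auto simp: admissible_def)
  have "(\<lambda>x. N - d < x) = (\<lambda>x. v \<le> x)"
    using \<open>d \<le> N\<close> v by (auto simp: fun_eq_iff)
  then have srt': "sorted (filter (\<lambda>x. v \<le> x) ?w)"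
    using srt unfolding filter_skip_block sorted_block_append by simp
  show ?thesis
  proof (intro set_eqI iffI)
    fix e
    assume e: "e \<in> {..d + m}"
    \<comment> \<open>Since \<open>e \<le> d + m\<close>, the threshold \<open>N + m - e\<close> is
      at least \<open>N - d = v - 1\<close>, so only entries from \<open>v\<close> on
      survive.\<close>
    have "filter (\<lambda>x. N + m - e < x) ?w =
        filter (\<lambda>x. N + m - e < x) (filter (\<lambda>x. v \<le> x) ?w)"
      unfolding filter_filter using e v \<open>d \<le> N\<close> by (intro filter_cong) auto
    then have "sorted (filter (\<lambda>x. N + m - e < x) ?w)"
      using srt' sorted_wrt_filter by metis
    then show "e \<in> admissible (N + m) ?w"
      using e \<open>d \<le> N\<close> by (simp add: admissible_def)
  next
    fix e
    assume e: "e \<in> admissible (N + m) ?w"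
    show "e \<in> {..d + m}"
    proof (rule ccontr)
      assume "e \<notin> {..d + m}"
      then have "d + m < e" "e \<le> N + m"
        using e by (auto simp: admissible_def)
      \<comment> \<open>The label \<open>N - d = v - 1\<close> just below the block is not moved by
        \<open>skip\<close> and stands to the right of \<open>v\<close>. For
        \<open>e > d + m\<close> both are among the \<open>e\<close> largest labels and form a
        descent.\<close>
      then have "N - d \<in> set xs" and "N - d < v" and lt: "N + m - e < N - d"
        using xs v by auto
      then have "N - d \<in> set (map (skip m v) xs)"
        by (auto simp: skip_def intro!: image_eqI[of _ _ "N - d"])
      with lt have 1: "N - d \<in> set (filter (\<lambda>x. N + m - e < x) (map (skip m v) xs))"
        by simp
      have 2: "v \<in> set (filter (\<lambda>x. N + m - e < x) [v..<v + m])"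
        using lt \<open>N - d < v\<close> \<open>0 < m\<close> by simp
      have "sorted (filter (\<lambda>x. N + m - e < x) [v..<v + m] @
          filter (\<lambda>x. N + m - e < x) (map (skip m v) xs))"
        using e by (simp add: admissible_def)
      then have "v \<le> N - d"
        using 1 2 unfolding sorted_append by blast
      then show False using \<open>N - d < v\<close> by simp
    qed
  qed
qed

section \<open>Decomposition of avoiding forests\<close>

definition forests_132 :: "nat \<Rightarrow> nat \<Rightarrow> shrub list set" where
  "forests_132 k n = avoiding_forests k n {[1, 3, 2]}"

lemma forests_132_iff:
  "F \<in> forests_132 k n \<longleftrightarrow> shrub_forest k n F \<and> avoids_132 (forest_perm F)"
  by (simp add: forests_132_def avoiding_forests_def contains_132_iff del: One_nat_def)

lemma forests_132_0: "forests_132 k 0 = {[]}"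
  by (auto simp: forests_132_iff shrub_forest_def forest_perm_def)

text \<open>The block and the image of \<open>{1..Suc k * n}\<close> under \<open>skip\<close>
  partition the new label set. Cancelling the block and using injectivity of \<open>skip\<close>
  gives both directions at once.\<close>

lemma shrub_forest_add_shrub_iff:
  assumes "1 \<le> v" "v \<le> Suc (Suc k * n)"
  shows "shrub_forest k (Suc n) (add_shrub k v F) \<longleftrightarrow> shrub_forest k n F"
proof -
  let ?m = "Suc k" and ?w = "forest_perm F"
  have img: "skip ?m v ` {1..?m * n} = {1..?m * n + ?m} - {v..<v + ?m}"
    by (rule skip_image[OF assms])
  have disj: "{v..<v + ?m} \<inter> skip ?m v ` A = {}" for A
    by (auto simp: skip_def)
  have sub: "{v..<v + ?m} \<subseteq> {1..?m * n + ?m}"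
    using assms by auto
  have "set (forest_perm (add_shrub k v F)) = {v..<v + ?m} \<union> skip ?m v ` set ?w"
    unfolding forest_perm_add_shrub by (simp only: set_append set_upt set_map)
  then have "set (forest_perm (add_shrub k v F)) = {1..?m * n + ?m} \<longleftrightarrow>
      skip ?m v ` set ?w = skip ?m v ` {1..?m * n}"
    unfolding img using disj[of "set ?w"] sub by blast
  then have 1: "set (forest_perm (add_shrub k v F)) = {1..?m * n + ?m} \<longleftrightarrow>
      set ?w = {1..?m * n}"
    by (simp only: inj_image_eq_iff[OF inj_skip])
  have 2: "distinct (forest_perm (add_shrub k v F)) \<longleftrightarrow> distinct ?w"
    unfolding forest_perm_add_shrub distinct_append set_map set_upt
    using disj[of "set ?w"] by (simp add: distinct_map inj_on_subset[OF inj_skip] del: upt_Suc)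
  have 3: "(\<forall>s\<in>set (add_shrub k v F). kary_shrub k s) \<longleftrightarrow> (\<forall>s\<in>set F. kary_shrub k s)"
    by (simp add: add_shrub_def kary_shrub_def relabel_def del: upt_Suc)
  have 4: "(\<forall>s\<in>set (add_shrub k v F). \<forall>x\<in>set (leaf_labels s). root_label s < x) \<longleftrightarrow>
      (\<forall>s\<in>set F. \<forall>x\<in>set (leaf_labels s). root_label s < x)"
    by (simp add: add_shrub_def relabel_def strict_mono_less[OF strict_mono_skip] del: upt_Suc)
  have 5: "length (add_shrub k v F) = Suc n \<longleftrightarrow> length F = n"
    by (simp add: add_shrub_def)
  have 6: "(k + 1) * Suc n = ?m * n + ?m" "(k + 1) * n = ?m * n"
    by simp_all
  show ?thesis
    unfolding shrub_forest_def 1 2 3 4 5 6 by blast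
qed

lemma add_shrub_in_forests_132_iff:
  assumes "d \<le> Suc k * n"
  shows "add_shrub k (Suc (Suc k * n) - d) F \<in> forests_132 k (Suc n) \<longleftrightarrow>
    F \<in> forests_132 k n \<and> d \<in> admissible (Suc k * n) (forest_perm F)"
proof -
  define v where "v = Suc (Suc k * n) - d"
  have v: "1 \<le> v" "v \<le> Suc (Suc k * n)"
    using assms by (auto simp: v_def)
  have "(\<lambda>x. Suc k * n - d < x) = (\<lambda>x. v \<le> x)"
    using assms by (auto simp: v_def fun_eq_iff)
  then show ?thesis
    unfolding v_def[symmetric] forests_132_iff shrub_forest_add_shrub_iff[OF v]
      forest_perm_add_shrub avoids_132_block[OF zero_less_Suc] admissible_def
    using assms by auto
qed

text \<open>By avoidance the labels above the first root \<open>r\<close> appear in increasing order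
  after it. The leaves come first among them, so they are the \<open>k\<close> successors of
  \<open>r\<close>; closing the gap left by this block recovers \<open>F\<close>.\<close>

lemma forests_132_SucE:
  assumes G: "G \<in> forests_132 k (Suc n)"
  obtains F d where "d \<le> Suc k * n" "G = add_shrub k (Suc (Suc k * n) - d) F"
proof -
  let ?m = "Suc k" and ?N = "Suc k * n"
  have sf: "shrub_forest k (Suc n) G" and av: "avoids_132 (forest_perm G)"
    using G by (auto simp: forests_132_iff)
  obtain s G' where Gs: "G = s # G'"
    using sf by (cases G) (auto simp: shrub_forest_def)
  obtain r ls where s: "s = Shrub r ls" by (cases s)
  define w where "w = forest_perm G'"
  have perm: "forest_perm G = r # ls @ w"
    by (simp add: Gs s forest_perm_Cons shrub_word_def w_def)
  have len: "length ls = k" and gt: "\<forall>x\<in>set ls. r < x"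
    using sf by (auto simp: shrub_forest_def Gs s kary_shrub_def)
  have dist: "distinct (r # ls @ w)" and st: "set (r # ls @ w) = {1..?N + ?m}"
    using sf unfolding shrub_forest_def perm by (auto simp: algebra_simps)
  have "sorted (filter (\<lambda>y. r < y) (ls @ w))"
    using av by (simp add: perm)
  moreover have "distinct (filter (\<lambda>y. r < y) (ls @ w))"
    using dist by (intro distinct_filter) simp
  moreover have "set (filter (\<lambda>y. r < y) (ls @ w)) = set [Suc r..<Suc (?N + ?m)]"
  proof -
    have "set (filter (\<lambda>y. r < y) (ls @ w)) = {x \<in> set (r # ls @ w). r < x}"
      by auto
    also have "\<dots> = set [Suc r..<Suc (?N + ?m)]"
      unfolding st set_upt by auto
    finally show ?thesis .
  qed
  ultimately have "filter (\<lambda>y. r < y) (ls @ w) = [Suc r..<Suc (?N + ?m)]"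
    by (intro sorted_distinct_set_unique) (auto simp del: upt_Suc)
  moreover have "filter (\<lambda>y. r < y) ls = ls"
    using gt by (simp add: filter_id_conv)
  ultimately have eq: "ls @ filter (\<lambda>y. r < y) w = [Suc r..<Suc (?N + ?m)]"
    by simp
  \<comment> \<open>There must be room for \<open>k\<close> leaves above \<open>r\<close>, which
    yields \<open>r \<le> Suc ?N\<close>.\<close>
  have "k \<le> length [Suc r..<Suc (?N + ?m)]"
    using len by (metis eq length_append le_add1)
  moreover have r: "1 \<le> r" "r \<le> ?N + ?m"
    using st by auto
  ultimately have r': "r \<le> Suc ?N"
    by (simp del: upt_Suc)
  have "ls = take k [Suc r..<Suc (?N + ?m)]"
    using len eq by (metis append_eq_conv_conj)
  also have "\<dots> = [Suc r..<Suc r + k]"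
    using r' by (intro take_upt) simp
  finally have ls: "ls = [Suc r..<r + ?m]"
    by simp
  define unskip where "unskip x = (if x < r then x else x - ?m)" for x
  have undo: "skip ?m r (unskip x) = x" if "x \<in> set w" for x
  proof -
    have "x \<notin> insert r (set ls)"
      using that dist by auto
    then have "x \<notin> {r..<r + ?m}"
      unfolding ls set_upt by auto
    then show ?thesis by (auto simp: skip_def unskip_def)
  qed
  have sub: "set (shrub_word t) \<subseteq> set w" if "t \<in> set G'" for t
    using that by (auto simp: w_def forest_perm_def)
  have "relabel (skip ?m r) (relabel unskip t) = t" if "t \<in> set G'" for t
    using sub[OF that] undo
    by (cases t) (auto simp: relabel_def shrub_word_def intro!: map_idI)
  then have "map (relabel (skip ?m r)) (map (relabel unskip) G') = G'"
    by (auto intro!: map_idI)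
  then have "G = add_shrub k r (map (relabel unskip) G')"
    unfolding add_shrub_def Gs s ls by simp
  \<comment> \<open>The depth is \<open>d = Suc ?N - r\<close>: \<open>r \<le> Suc ?N\<close> makes
    the subtraction exact, and \<open>1 \<le> r\<close> gives \<open>d \<le> ?N\<close>.\<close>
  moreover have "r = Suc ?N - (Suc ?N - r)" "Suc ?N - r \<le> ?N"
    using r r' by auto
  ultimately show ?thesis
    by (metis that)
qed

text \<open>For injectivity, the first root label determines \<open>d\<close>, and then injectivity
  of \<open>relabel\<close> determines \<open>F\<close>.\<close>

lemma bij_betw_add_shrub:
  "bij_betw (\<lambda>(F, d). add_shrub k (Suc (Suc k * n) - d) F)
     (SIGMA F:forests_132 k n. admissible (Suc k * n) (forest_perm F)) (forests_132 k (Suc n))"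
proof (rule bij_betw_imageI)
  show "inj_on (\<lambda>(F, d). add_shrub k (Suc (Suc k * n) - d) F)
     (SIGMA F:forests_132 k n. admissible (Suc k * n) (forest_perm F))"
    by (auto simp: inj_on_def add_shrub_def admissible_def
        inj_map_eq_map[OF inj_relabel[OF inj_skip]] simp del: upt_Suc)
  have le: "d \<le> Suc k * n" if "d \<in> admissible (Suc k * n) xs" for d xs
    using that by (simp add: admissible_def)
  show "(\<lambda>(F, d). add_shrub k (Suc (Suc k * n) - d) F) `
     (SIGMA F:forests_132 k n. admissible (Suc k * n) (forest_perm F)) = forests_132 k (Suc n)"
  proof (intro set_eqI iffI)
    fix G
    assume "G \<in> (\<lambda>(F, d). add_shrub k (Suc (Suc k * n) - d) F) `
     (SIGMA F:forests_132 k n. admissible (Suc k * n) (forest_perm F))"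
    then show "G \<in> forests_132 k (Suc n)"
      using add_shrub_in_forests_132_iff le by fastforce
  next
    fix G
    assume G: "G \<in> forests_132 k (Suc n)"
    then obtain F d where d: "d \<le> Suc k * n" "G = add_shrub k (Suc (Suc k * n) - d) F"
      by (rule forests_132_SucE)
    with G have "F \<in> forests_132 k n \<and> d \<in> admissible (Suc k * n) (forest_perm F)"
      using add_shrub_in_forests_132_iff by blast
    then show "G \<in> (\<lambda>(F, d). add_shrub k (Suc (Suc k * n) - d) F) `
     (SIGMA F:forests_132 k n. admissible (Suc k * n) (forest_perm F))"
      using d(2) by (auto intro!: image_eqI[of _ _ "(F, d)"])
  qed
qed

section \<open>Counting forests by their bounds\<close>

lemma finite_forests_132: "finite (forests_132 k n)"
proof (induction n)
  case 0
  show ?case by (simp add: forests_132_0)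
next
  case (Suc n)
  have "finite (SIGMA F:forests_132 k n. admissible (Suc k * n) (forest_perm F))"
    using Suc.IH by (intro finite_SigmaI) (auto simp: admissible_def)
  then show ?case
    using bij_betw_finite[OF bij_betw_add_shrub[of k n]] by simp
qed

lemma admissible_add_shrub:
  assumes "F \<in> forests_132 k n" "d \<in> admissible (Suc k * n) (forest_perm F)"
  shows "admissible (Suc k * Suc n) (forest_perm (add_shrub k (Suc (Suc k * n) - d) F)) =
    {..d + Suc k}"
proof -
  have "set (forest_perm F) = {1..Suc k * n}"
    using assms(1) by (simp add: forests_132_iff shrub_forest_def)
  from admissible_block[OF assms(2) this zero_less_Suc refl, of k]
  show ?thesis
    unfolding forest_perm_add_shrub by (simp add: algebra_simps del: upt_Suc)
qed

definition bound :: "nat \<Rightarrow> nat \<Rightarrow> shrub list \<Rightarrow> nat" where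
  "bound k n F = Max (admissible (Suc k * n) (forest_perm F))"

text \<open>A nonempty forest arises by an insertion, after which the admissible depths form an
  initial segment; for the empty forest the set is \<open>{0}\<close>.\<close>

lemma admissible_eq_atMost_bound:
  assumes "F \<in> forests_132 k n"
  shows "admissible (Suc k * n) (forest_perm F) = {..bound k n F}"
proof -
  have "\<exists>t. admissible (Suc k * n) (forest_perm F) = {..t}"
  proof (cases n)
    case 0
    then show ?thesis
      using assms by (auto simp: forests_132_0 admissible_def forest_perm_def)
  next
    case (Suc i)
    obtain F' d where F': "d \<le> Suc k * i" "F = add_shrub k (Suc (Suc k * i) - d) F'"
      using assms unfolding Suc by (rule forests_132_SucE)
    then show ?thesis
      using assms add_shrub_in_forests_132_iff admissible_add_shrub unfolding Suc by metis
  qed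
  moreover have "Max {..t} = t" for t :: nat
    by (intro Max_eqI) auto
  ultimately show ?thesis by (auto simp: bound_def)
qed

text \<open>Here \<open>j\<close> insertions are still to be made after the first \<open>n\<close>,
  and the total does not depend on how \<open>n + j\<close> is split. For \<open>j = 0\<close> every
  summand is \<open>1\<close>, so the sum is the number of forests.\<close>

lemma sum_raney_bound:
  "(\<Sum>F\<in>forests_132 k n. raney (Suc k) j (bound k n F)) = raney (Suc k) (n + j) 0"
proof (induction n arbitrary: j)
  case 0
  have "admissible 0 [] = {0}" by (auto simp: admissible_def)
  then show ?case by (simp add: forests_132_0 bound_def forest_perm_def)
next
  case (Suc n)
  let ?m = "Suc k" and ?A = "\<lambda>F. admissible (Suc k * n) (forest_perm F)"
  have max: "bound k (Suc n) (add_shrub k (Suc (?m * n) - d) F) = d + ?m"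
    if "F \<in> forests_132 k n" "d \<in> ?A F" for F d
    unfolding bound_def admissible_add_shrub[OF that] by (intro Max_eqI) auto
  have "(\<Sum>G\<in>forests_132 k (Suc n). raney ?m j (bound k (Suc n) G)) =
      (\<Sum>(F, d)\<in>(SIGMA F:forests_132 k n. ?A F).
        raney ?m j (bound k (Suc n) (add_shrub k (Suc (?m * n) - d) F)))"
    by (subst sum.reindex_bij_betw[OF bij_betw_add_shrub, symmetric])
      (simp add: case_prod_unfold)
  also have "\<dots> = (\<Sum>(F, d)\<in>(SIGMA F:forests_132 k n. ?A F). raney ?m j (d + ?m))"
    by (intro sum.cong) (auto simp: max simp del: mult_Suc)
  also have "\<dots> = (\<Sum>F\<in>forests_132 k n. \<Sum>d\<in>?A F. raney ?m j (d + ?m))"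
    by (intro sum.Sigma[symmetric] finite_forests_132) (auto simp: admissible_def)
  \<comment> \<open>The inner sum runs over \<open>{..bound k n F}\<close>, so it is the recursion
    of \<open>raney\<close> read backwards: the last insertion becomes one still to be made.\<close>
  also have "\<dots> = (\<Sum>F\<in>forests_132 k n. raney ?m (Suc j) (bound k n F))"
    by (intro sum.cong) (simp_all only: admissible_eq_atMost_bound raney.simps)
  also have "\<dots> = raney ?m (Suc n + j) 0"
    using Suc.IH[of "Suc j"] by simp
  finally show ?case .
qed

lemma card_forests_132: "card (forests_132 k n) = raney (Suc k) n 0"
  using sum_raney_bound[where j = 0] by simp

theorem theorem6:
  fixes k n :: nat
  assumes "k \<ge> 1"
  shows "real (card (avoiding_forests k n {[1, 3, 2]})) =
           1 / real ((k + 1) * n + 1) * real (((k + 2) * n) choose n)"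
  unfolding forests_132_def[symmetric] card_forests_132 raney_0_eq by simp

end
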